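(* Let $G$ be a finite nonabelian simple group, $M$ a maximal subgroup of $G$, $g\in M\setminus\{1\}$, and let $\mathcal{D}=(\mathcal{P},\mathcal{B})$ be the $1$-design with $\mathcal{P}=g^G$ and $\mathcal{B}=\{(M\cap g^G)^y: y\in G\}$. Then $G\cong\widetilde{G}\leq AD(G)\leq \mathrm{Aut}(\mathcal{D})$ (as groups of permutations of $\mathcal{P}$).
   Context: For $u,x\in G$, $u^x=x^{-1}ux$, and for a subset $B\subseteq G$, $B^x=\{u^x:u\in B\}$; $g^G$ is the conjugacy class of $g$. $\mathcal{D}$ is a $1$-$(|g^G|,|M\cap g^G|,1_M^G(g))$ design, where $1_M^G$ is the permutation character of $G$ on the cosets of $M$. $\mathrm{Aut}(\mathcal{D})$ is the group of permutations of $\mathcal{P}$ that map blocks to blocks. For $x\in G$, $\widetilde{x}$ is the permutation $u\mapsto u^x$ of $\mathcal{P}$ (acting on blocks by $B\mapsto B^x$), and $\widetilde{G}:=\{\widetilde{x}:x\in G\}$. For $\phi\in\mathrm{Aut}(G)$, $\widetilde\phi$ is the map defined by $\widetilde\phi(u):=\phi(u)$ for $u\in\mathcal{P}$ and $\widetilde\phi(B):=\{\phi(v):v\in B\}$ for blocks $B$. Finally, $$AD(G):=\{\widetilde\phi:\phi\in\mathrm{Aut}(G)\text{ such that }\phi(g)\in g^G\text{ and }\phi(M)=M^x\text{ for some }x\in G\}.$$ *)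

theory Defs
  imports "HOL-Algebra.SimpleGroups" "HOL-Algebra.Bij"
begin

definition conj_elem :: "('a, 'b) monoid_scheme \<Rightarrow> 'a \<Rightarrow> 'a \<Rightarrow> 'a" where
  "conj_elem G u x = inv\<^bsub>G\<^esub> x \<otimes>\<^bsub>G\<^esub> u \<otimes>\<^bsub>G\<^esub> x"

definition conj_set :: "('a, 'b) monoid_scheme \<Rightarrow> 'a set \<Rightarrow> 'a \<Rightarrow> 'a set" where
  "conj_set G B x = {conj_elem G u x | u. u \<in> B}"

definition conj_class :: "('a, 'b) monoid_scheme \<Rightarrow> 'a \<Rightarrow> 'a set" where
  "conj_class G g = {conj_elem G g x | x. x \<in> carrier G}"

definition maximal_subgroup :: "'a set \<Rightarrow> ('a, 'b) monoid_scheme \<Rightarrow> bool" where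
  "maximal_subgroup M G \<longleftrightarrow> subgroup M G \<and> M \<noteq> carrier G \<and>
     (\<forall>H. subgroup H G \<longrightarrow> M \<subseteq> H \<longrightarrow> H = M \<or> H = carrier G)"


text \<open>An incidence structure is a pair of its set of points and its set of blocks,
  blocks being sets of points. In a 1-(v, k, r) design every point lies on exactly r blocks.\<close>

type_synonym 'p incidence = "'p set \<times> 'p set set"

definition points :: "'p incidence \<Rightarrow> 'p set" where
  "points D = fst D"

definition blocks :: "'p incidence \<Rightarrow> 'p set set" where
  "blocks D = snd D"

definition one_design :: "nat \<Rightarrow> nat \<Rightarrow> nat \<Rightarrow> 'p incidence \<Rightarrow> bool" where
  "one_design v k r D \<longleftrightarrow>
     finite (points D) \<and> card (points D) = v \<and>
     (\<forall>B \<in> blocks D. B \<subseteq> points D \<and> card B = k) \<and>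
     (\<forall>p \<in> points D. card {B \<in> blocks D. p \<in> B} = r)"

definition design_aut :: "'p incidence \<Rightarrow> ('p \<Rightarrow> 'p) set" where
  "design_aut D = {f \<in> Bij (points D). \<forall>B \<in> blocks D. f ` B \<in> blocks D}"

text \<open>The group structure is that of \<^const>\<open>BijGroup\<close>, i.e. composition of functions
  (right factor first).\<close>

definition design_aut_group :: "'p incidence \<Rightarrow> ('p \<Rightarrow> 'p) monoid" where
  "design_aut_group D = BijGroup (points D) \<lparr>carrier := design_aut D\<rparr>"


definition conj_design :: "('a, 'b) monoid_scheme \<Rightarrow> 'a set \<Rightarrow> 'a \<Rightarrow> 'a incidence" where
  "conj_design G M g =
     (conj_class G g, {conj_set G (M \<inter> conj_class G g) y | y. y \<in> carrier G})"

text \<open>As permutations of the point set, the maps below are restricted to the conjugacy class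
  of g, in line with the extensional functions of \<^const>\<open>Bij\<close>. Their actions on blocks
  are the induced ones, by taking images.\<close>

definition conj_perm :: "('a, 'b) monoid_scheme \<Rightarrow> 'a \<Rightarrow> 'a \<Rightarrow> 'a \<Rightarrow> 'a" where
  "conj_perm G g x = (\<lambda>u \<in> conj_class G g. conj_elem G u x)"

definition conj_perms :: "('a, 'b) monoid_scheme \<Rightarrow> 'a \<Rightarrow> ('a \<Rightarrow> 'a) set" where
  "conj_perms G g = {conj_perm G g x | x. x \<in> carrier G}"

text \<open>With functions composed from right to left, \<^term>\<open>conj_perm G g\<close> is an
  anti-homomorphism; an isomorphism from G sends x to the permutation induced by its inverse.\<close>

definition conj_perms_group :: "('a, 'b) monoid_scheme \<Rightarrow> 'a \<Rightarrow> ('a \<Rightarrow> 'a) monoid" where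
  "conj_perms_group G g = BijGroup (conj_class G g) \<lparr>carrier := conj_perms G g\<rparr>"

definition aut_perm :: "('a, 'b) monoid_scheme \<Rightarrow> 'a \<Rightarrow> ('a \<Rightarrow> 'a) \<Rightarrow> 'a \<Rightarrow> 'a" where
  "aut_perm G g \<phi> = (\<lambda>u \<in> conj_class G g. \<phi> u)"

definition AD :: "('a, 'b) monoid_scheme \<Rightarrow> 'a set \<Rightarrow> 'a \<Rightarrow> ('a \<Rightarrow> 'a) set" where
  "AD G M g = {aut_perm G g \<phi> | \<phi>. \<phi> \<in> auto G \<and> \<phi> g \<in> conj_class G g \<and>
     (\<exists>x \<in> carrier G. \<phi> ` M = conj_set G M x)}"

definition AD_group :: "('a, 'b) monoid_scheme \<Rightarrow> 'a set \<Rightarrow> 'a \<Rightarrow> ('a \<Rightarrow> 'a) monoid" where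
  "AD_group G M g = BijGroup (conj_class G g) \<lparr>carrier := AD G M g\<rparr>"


text \<open>Mapping blocks to blocks is closed under inverses because the designs are finite.\<close>

lemma subgroup_design_aut:
  assumes fin: "finite (points D)" and sub: "\<And>B. B \<in> blocks D \<Longrightarrow> B \<subseteq> points D"
  shows "subgroup (design_aut D) (BijGroup (points D))"
proof (rule group.subgroupI[OF group_BijGroup])
  let ?P = "points D"
  show "design_aut D \<subseteq> carrier (BijGroup ?P)"
    by (auto simp: design_aut_def BijGroup_def)
  have "(\<lambda>x\<in>?P. x) ` B = B" if "B \<in> blocks D" for B
    using sub[OF that] by (auto simp: restrict_def image_iff subset_iff)
  then show "design_aut D \<noteq> {}"
    by (auto simp: design_aut_def intro!: exI[of _ "\<lambda>x\<in>?P. x"] id_Bij)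
  fix a assume a: "a \<in> design_aut D"
  then have aB: "a \<in> Bij ?P" and ab: "\<And>B. B \<in> blocks D \<Longrightarrow> a ` B \<in> blocks D"
    by (auto simp: design_aut_def)
  then have bij: "bij_betw a ?P ?P" by (simp add: Bij_def)
  have finb: "finite (blocks D)"
    by (rule finite_subset[of _ "Pow ?P"]) (use sub fin in auto)
  have inj: "inj_on ((`) a) (blocks D)"
    by (rule inj_on_subset[OF inj_on_image_Pow]) (use bij sub in \<open>auto simp: bij_betw_def\<close>)
  have surj: "((`) a) ` blocks D = blocks D"
    by (rule endo_inj_surj[OF finb _ inj]) (use ab in auto)
  show "inv\<^bsub>BijGroup ?P\<^esub> a \<in> design_aut D"
  proof -
    have "(\<lambda>x\<in>?P. inv_into ?P a x) ` B \<in> blocks D" if B: "B \<in> blocks D" for B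
    proof -
      obtain C where C: "C \<in> blocks D" "B = a ` C" using surj B by blast
      have "(\<lambda>x\<in>?P. inv_into ?P a x) ` B = (inv_into ?P a) ` B"
        using sub[OF B] by (intro image_cong) auto
      also have "\<dots> = C"
        unfolding C(2) using sub[OF C(1)] bij
        by (simp add: bij_betw_def inv_into_image_cancel)
      finally show ?thesis using C by simp
    qed
    then show ?thesis
      using aB by (simp add: inv_BijGroup design_aut_def restrict_inv_into_Bij)
  qed
  fix b assume b: "b \<in> design_aut D"
  have "compose ?P a b ` B \<in> blocks D" if B: "B \<in> blocks D" for B
  proof -
    have "compose ?P a b ` B = a ` (b ` B)"
      using sub[OF B] by (auto simp: compose_def image_iff subset_iff)
    then show ?thesis using b B ab by (auto simp: design_aut_def)
  qed
  then show "a \<otimes>\<^bsub>BijGroup ?P\<^esub> b \<in> design_aut D"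
    using a b by (auto simp: design_aut_def BijGroup_def compose_Bij)
qed

context group
begin

lemma conj_elem_closed: "u \<in> carrier G \<Longrightarrow> x \<in> carrier G \<Longrightarrow> conj_elem G u x \<in> carrier G"
  by (simp add: conj_elem_def)

lemma conj_elem_mult:
  "u \<in> carrier G \<Longrightarrow> x \<in> carrier G \<Longrightarrow> y \<in> carrier G \<Longrightarrow>
     conj_elem G (conj_elem G u x) y = conj_elem G u (x \<otimes> y)"
  by (simp add: conj_elem_def inv_mult_group m_assoc)

lemma conj_elem_one: "u \<in> carrier G \<Longrightarrow> conj_elem G u \<one> = u"
  by (simp add: conj_elem_def)

lemma inj_conj_elem: "x \<in> carrier G \<Longrightarrow> inj_on (\<lambda>u. conj_elem G u x) (carrier G)"
  by (intro inj_onI) (simp add: conj_elem_def)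

lemma conj_set_eq_image: "conj_set G B x = (\<lambda>u. conj_elem G u x) ` B"
  by (auto simp: conj_set_def)

lemma conj_class_subset: "g \<in> carrier G \<Longrightarrow> conj_class G g \<subseteq> carrier G"
  by (auto simp: conj_class_def conj_elem_closed)

lemma conj_elem_class:
  assumes "g \<in> carrier G" "u \<in> conj_class G g" "x \<in> carrier G"
  shows "conj_elem G u x \<in> conj_class G g"
  using assms unfolding conj_class_def by (auto simp: conj_elem_mult)

lemma conj_set_mult:
  "B \<subseteq> carrier G \<Longrightarrow> x \<in> carrier G \<Longrightarrow> y \<in> carrier G \<Longrightarrow>
     conj_set G (conj_set G B x) y = conj_set G B (x \<otimes> y)"
  by (force simp: conj_set_eq_image image_image conj_elem_mult subset_iff intro!: image_cong)

lemma one_design_conj_design: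
  assumes fin: "finite (carrier G)" and g: "g \<in> carrier G"
  shows "one_design (card (conj_class G g)) (card (M \<inter> conj_class G g))
           (card {B \<in> blocks (conj_design G M g). g \<in> B}) (conj_design G M g)"
proof -
  let ?P = "conj_class G g" and ?Bs = "blocks (conj_design G M g)"
  note P = conj_class_subset[OF g]
  have Bs: "?Bs = (\<lambda>y. conj_set G (M \<inter> ?P) y) ` carrier G"
    by (auto simp: conj_design_def blocks_def)
  have BP: "B \<subseteq> ?P \<and> card B = card (M \<inter> ?P)" if "B \<in> ?Bs" for B
  proof -
    from that obtain y where y: "y \<in> carrier G" "B = conj_set G (M \<inter> ?P) y"
      unfolding Bs by auto
    then show ?thesis
      using P g card_image[OF inj_on_subset[OF inj_conj_elem[OF y(1)], of "M \<inter> ?P"]]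
      by (auto simp: conj_set_eq_image conj_elem_class)
  qed
  have move: "conj_set G B x \<in> ?Bs" if "B \<in> ?Bs" "x \<in> carrier G" for B x
    using that P unfolding Bs by (auto simp: conj_set_mult le_infI2)
  have "bij_betw (\<lambda>B. conj_set G B x) {B \<in> ?Bs. g \<in> B} {B \<in> ?Bs. conj_elem G g x \<in> B}"
    if x: "x \<in> carrier G" for x
  proof (rule bij_betw_byWitness[where f' = "\<lambda>B. conj_set G B (inv x)"])
    have id: "conj_set G B \<one> = B" if "B \<in> ?Bs" for B
      using BP[OF that] P by (force simp: conj_set_eq_image conj_elem_one subset_iff image_iff)
    have sub: "B \<subseteq> carrier G" if "B \<in> ?Bs" for B using BP[OF that] P by auto
    show "\<forall>B\<in>{B \<in> ?Bs. g \<in> B}. conj_set G (conj_set G B x) (inv x) = B"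
      using x sub id by (simp add: conj_set_mult)
    show "\<forall>B\<in>{B \<in> ?Bs. conj_elem G g x \<in> B}. conj_set G (conj_set G B (inv x)) x = B"
      using x sub id by (simp add: conj_set_mult)
    show "(\<lambda>B. conj_set G B x) ` {B \<in> ?Bs. g \<in> B} \<subseteq> {B \<in> ?Bs. conj_elem G g x \<in> B}"
      using x move by (auto simp: conj_set_def)
    have "g = conj_elem G (conj_elem G g x) (inv x)"
      using g x by (simp add: conj_elem_mult conj_elem_one)
    then show "(\<lambda>B. conj_set G B (inv x)) ` {B \<in> ?Bs. conj_elem G g x \<in> B} \<subseteq> {B \<in> ?Bs. g \<in> B}"
      using x move by (auto simp: conj_set_def)
  qed
  then have "card {B \<in> ?Bs. p \<in> B} = card {B \<in> ?Bs. g \<in> B}" if "p \<in> ?P" for p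
    using that by (auto simp: conj_class_def intro: bij_betw_same_card[symmetric])
  moreover have "points (conj_design G M g) = ?P" by (simp add: conj_design_def points_def)
  ultimately show ?thesis
    using BP finite_subset[OF P fin] by (auto simp: one_design_def)
qed

lemma group_design_aut_group_conj_design:
  assumes "finite (carrier G)" "g \<in> carrier G"
  shows "group (design_aut_group (conj_design G M g))"
  unfolding design_aut_group_def
  using one_design_conj_design[OF assms, of M]
  by (intro subgroup.subgroup_is_group[OF subgroup_design_aut group_BijGroup])
     (auto simp: one_design_def)

end

end

theory Submission
  imports Defs
begin

text \<open>
  Every permutation in play is the image of a group element or of an automorphism under a
  homomorphism into the symmetric group on the class \<open>P\<close> of \<open>g\<close>, so the subgroup
  claims reduce to inclusions of sets.

  Sending \<open>x\<close> to conjugation by the inverse of \<open>x\<close> on \<open>P\<close> is a homomorphism whose image is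
  \<^const>\<open>conj_perms\<close>. Its kernel is normal. It is not all of \<open>G\<close>: otherwise \<open>g\<close> would be
  central, and the centre, being normal and nontrivial, would be \<open>G\<close>, which is
  nonabelian. By simplicity the kernel is trivial, which gives the isomorphism.

  For a subset \<open>S\<close> of \<open>G\<close>, the automorphisms that map \<open>S\<close> to a conjugate of \<open>S\<close> form a group
  (\<open>subgroup_conj_stabilizer\<close>). The two conditions defining \<^const>\<open>AD\<close> are the cases \<open>S = {g}\<close>
  and \<open>S = M\<close>, so \<^const>\<open>AD\<close> is the image of the intersection of two such groups under
  restriction to \<open>P\<close>. Inner automorphisms map every \<open>S\<close> to a conjugate, hence \<^const>\<open>AD\<close>
  contains \<^const>\<open>conj_perms\<close>. Finally, an automorphism \<open>\<phi>\<close> with \<open>\<phi> ` P = P\<close> and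
  \<open>\<phi> ` M = M\<^sup>x\<close> sends the block \<open>(M \<inter> P)\<^sup>y\<close> to the block \<open>(M \<inter> P)\<^sup>z\<close>, where \<open>z\<close> is the
  product of \<open>x\<close> and \<open>\<phi> y\<close>.
\<close>

context group
begin

section \<open>Conjugation and automorphisms\<close>

lemma auto_closed: "\<phi> \<in> auto G \<Longrightarrow> x \<in> carrier G \<Longrightarrow> \<phi> x \<in> carrier G"
  by (auto simp: auto_def hom_def)

lemma auto_inj: "\<phi> \<in> auto G \<Longrightarrow> inj_on \<phi> (carrier G)"
  by (auto simp: auto_def Bij_def bij_betw_def)

lemma auto_surj: "\<phi> \<in> auto G \<Longrightarrow> \<phi> ` carrier G = carrier G"
  by (auto simp: auto_def Bij_def bij_betw_def)

lemma auto_conj_elem: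
  assumes "\<phi> \<in> auto G" "u \<in> carrier G" "x \<in> carrier G"
  shows "\<phi> (conj_elem G u x) = conj_elem G (\<phi> u) (\<phi> x)"
proof -
  interpret \<phi>: group_hom G G \<phi>
    using assms(1) by unfold_locales (simp add: auto_def)
  show ?thesis using assms by (simp add: conj_elem_def)
qed

lemma auto_conj_set:
  assumes "\<phi> \<in> auto G" "B \<subseteq> carrier G" "x \<in> carrier G"
  shows "\<phi> ` conj_set G B x = conj_set G (\<phi> ` B) (\<phi> x)"
  unfolding conj_set_eq_image image_image
  using assms by (intro image_cong) (auto simp: auto_conj_elem)

lemma conj_set_one: "B \<subseteq> carrier G \<Longrightarrow> conj_set G B \<one> = B"
  by (force simp: conj_set_eq_image conj_elem_one subset_iff image_iff)

lemma conj_set_Int: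
  assumes "A \<subseteq> carrier G" "B \<subseteq> carrier G" "x \<in> carrier G"
  shows "conj_set G (A \<inter> B) x = conj_set G A x \<inter> conj_set G B x"
  unfolding conj_set_eq_image
  using inj_on_image_Int[OF inj_conj_elem[OF assms(3)] assms(1,2)] .

lemma conj_set_conj_class:
  assumes g: "g \<in> carrier G" and x: "x \<in> carrier G"
  shows "conj_set G (conj_class G g) x = conj_class G g"
proof
  note P = conj_class_subset[OF g]
  have sub: "conj_set G (conj_class G g) y \<subseteq> conj_class G g" if "y \<in> carrier G" for y
    using g that by (auto simp: conj_set_eq_image conj_elem_class)
  show "conj_set G (conj_class G g) x \<subseteq> conj_class G g"
    by (rule sub[OF x])
  have "conj_class G g = conj_set G (conj_set G (conj_class G g) (inv x)) x"
    using P x by (simp add: conj_set_mult conj_set_one)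
  also have "\<dots> \<subseteq> conj_set G (conj_class G g) x"
    unfolding conj_set_eq_image[of _ x] by (rule image_mono) (simp add: sub x)
  finally show "conj_class G g \<subseteq> conj_set G (conj_class G g) x" .
qed

text \<open>If \<open>\<phi> g = g\<^sup>z\<close>, then \<open>\<phi>\<close> maps \<open>g\<^sup>y\<close> to the conjugate of \<open>g\<close> by the product of \<open>z\<close> and
  \<open>\<phi> y\<close>, and this product runs over the whole group as \<open>y\<close> does. So \<open>\<phi>\<close> is onto the class
  even when the class is infinite.\<close>

lemma auto_image_conj_class:
  assumes "\<phi> \<in> auto G" "g \<in> carrier G" "\<phi> g \<in> conj_class G g"
  shows "\<phi> ` conj_class G g = conj_class G g"
proof -
  obtain z where z: "z \<in> carrier G" "\<phi> g = conj_elem G g z"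
    using assms(3) by (auto simp: conj_class_def)
  have class_eq: "conj_class G u = conj_elem G u ` carrier G" for u
    by (auto simp: conj_class_def)
  have "\<phi> ` conj_class G g = (\<lambda>y. conj_elem G (\<phi> g) (\<phi> y)) ` carrier G"
    unfolding class_eq image_image
    by (intro image_cong) (use assms in \<open>auto simp: auto_conj_elem\<close>)
  also have "\<dots> = conj_elem G (conj_elem G g z) ` \<phi> ` carrier G"
    by (simp add: z(2) image_image)
  also have "\<dots> = conj_elem G g ` (\<lambda>y. z \<otimes> y) ` carrier G"
    unfolding auto_surj[OF assms(1)] image_image
    by (intro image_cong) (use assms z in \<open>auto simp: conj_elem_mult\<close>)
  also have "\<dots> = conj_class G g"
    unfolding class_eq using z(1) by (simp add: surj_const_mult)
  finally show ?thesis .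
qed

lemma inner_auto:
  assumes "x \<in> carrier G"
  shows "(\<lambda>u\<in>carrier G. conj_elem G u x) \<in> auto G"
proof -
  have "(\<lambda>u. conj_elem G u x) ` carrier G = carrier G"
  proof
    show "carrier G \<subseteq> (\<lambda>u. conj_elem G u x) ` carrier G"
    proof
      fix u assume u: "u \<in> carrier G"
      then have "u = conj_elem G (conj_elem G u (inv x)) x"
        using assms by (simp add: conj_elem_mult conj_elem_one)
      then show "u \<in> (\<lambda>u. conj_elem G u x) ` carrier G"
        using u assms by (intro image_eqI[where x = "conj_elem G u (inv x)"])
          (auto simp: conj_elem_closed)
    qed
  qed (use assms in \<open>auto simp: conj_elem_closed\<close>)
  then have "(\<lambda>u\<in>carrier G. conj_elem G u x) \<in> Bij (carrier G)"
    using inj_conj_elem[OF assms] by (simp add: Bij_def bij_betw_def inj_on_def)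
  moreover have "conj_elem G (u \<otimes> v) x = conj_elem G u x \<otimes> conj_elem G v x"
    if "u \<in> carrier G" "v \<in> carrier G" for u v
  proof -
    have "x \<otimes> (inv x \<otimes> (v \<otimes> x)) = v \<otimes> x"
      using that assms by (simp flip: m_assoc)
    then show ?thesis
      using that assms by (simp add: conj_elem_def m_assoc)
  qed
  then have "(\<lambda>u\<in>carrier G. conj_elem G u x) \<in> hom G G"
    using assms by (auto simp: hom_def conj_elem_closed)
  ultimately show ?thesis by (simp add: auto_def)
qed

section \<open>Automorphisms that preserve a set up to conjugacy\<close>

definition conj_stabilizer :: "'a set \<Rightarrow> ('a \<Rightarrow> 'a) set" where
  "conj_stabilizer S = {\<phi> \<in> auto G. \<exists>x\<in>carrier G. \<phi> ` S = conj_set G S x}"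

text \<open>Two automorphisms \<open>\<phi>, \<psi>\<close> with \<open>\<phi> ` S = S\<^sup>x\<close> and \<open>\<psi> ` S = S\<^sup>y\<close> compose to one mapping \<open>S\<close>
  to its conjugate by the product of \<open>x\<close> and \<open>\<phi> y\<close>. Applying the inverse of \<open>\<phi>\<close> to
  \<open>\<phi> ` S = S\<^sup>x\<close> shows that it maps \<open>S\<close> to the conjugate by the inverse of the preimage of \<open>x\<close>.\<close>

lemma subgroup_conj_stabilizer:
  assumes S: "S \<subseteq> carrier G"
  shows "subgroup (conj_stabilizer S) (BijGroup (carrier G))"
proof (rule group.subgroupI[OF group_BijGroup])
  let ?C = "carrier G"
  interpret A: subgroup "auto G" "BijGroup ?C"
    by (rule subgroup_auto)
  show "conj_stabilizer S \<subseteq> carrier (BijGroup ?C)"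
    using A.subset by (auto simp: conj_stabilizer_def)
  have "(\<lambda>u\<in>?C. u) ` S = conj_set G S \<one>"
    using S by (force simp: conj_set_one)
  then show "conj_stabilizer S \<noteq> {}"
    using id_in_auto unfolding conj_stabilizer_def by blast
  fix a assume a: "a \<in> conj_stabilizer S"
  then obtain x where aA: "a \<in> auto G" and x: "x \<in> ?C" "a ` S = conj_set G S x"
    by (auto simp: conj_stabilizer_def)
  have aB: "a \<in> Bij ?C" using aA by (simp add: auto_def)
  show "inv\<^bsub>BijGroup ?C\<^esub> a \<in> conj_stabilizer S"
  proof -
    obtain w where w: "w \<in> ?C" "x = a w"
      using auto_surj[OF aA] x(1) by blast
    have T: "conj_set G S (inv w) \<subseteq> ?C"
      using S w by (auto simp: conj_set_eq_image conj_elem_closed)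
    have "a ` conj_set G S (inv w) = S"
    proof -
      interpret a: group_hom G G a
        using aA by unfold_locales (simp add: auto_def)
      have "a ` conj_set G S (inv w) = conj_set G (conj_set G S x) (inv x)"
        using aA S w x by (simp add: auto_conj_set)
      also have "\<dots> = S" using S x by (simp add: conj_set_mult conj_set_one)
      finally show ?thesis .
    qed
    then have "inv_into ?C a ` S = conj_set G S (inv w)"
      using inv_into_image_cancel[OF auto_inj[OF aA] T] by simp
    moreover have "(inv\<^bsub>BijGroup ?C\<^esub> a) ` S = inv_into ?C a ` S"
      using S by (intro image_cong) (auto simp: inv_BijGroup[OF aB])
    ultimately show ?thesis
      using A.m_inv_closed[OF aA] w by (auto simp: conj_stabilizer_def)
  qed
  fix b assume b: "b \<in> conj_stabilizer S"
  then obtain y where bA: "b \<in> auto G" and y: "y \<in> ?C" "b ` S = conj_set G S y"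
    by (auto simp: conj_stabilizer_def)
  have "(a \<otimes>\<^bsub>BijGroup ?C\<^esub> b) ` S = a ` b ` S"
    unfolding image_image using S aB bA
    by (intro image_cong) (auto simp: BijGroup_def compose_def auto_def)
  also have "\<dots> = conj_set G S (x \<otimes> a y)"
    using aA S x y by (simp add: auto_conj_set conj_set_mult auto_closed)
  finally show "a \<otimes>\<^bsub>BijGroup ?C\<^esub> b \<in> conj_stabilizer S"
    using A.m_closed[OF aA bA] x y auto_closed[OF aA] by (auto simp: conj_stabilizer_def)
qed

section \<open>Permutations of the conjugacy class\<close>

text \<open>The conjugates of \<open>{g}\<close> are the singletons of members of the class, which turns the condition on
  \<open>\<phi> g\<close> in \<^const>\<open>AD\<close> into a stabilizer condition of the same kind as the one on \<open>M\<close>.\<close>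

lemma conj_stabilizer_singleton:
  "conj_stabilizer {g} = {\<phi> \<in> auto G. \<phi> g \<in> conj_class G g}"
  by (auto simp: conj_stabilizer_def conj_class_def conj_set_eq_image)

lemma AD_eq_image:
  "AD G M g = aut_perm G g ` (conj_stabilizer {g} \<inter> conj_stabilizer M)"
  unfolding AD_def conj_stabilizer_singleton conj_stabilizer_def[of M] by blast

lemma aut_perm_Bij:
  assumes "g \<in> carrier G" "\<phi> \<in> conj_stabilizer {g}"
  shows "aut_perm G g \<phi> \<in> Bij (conj_class G g)"
  using assms conj_class_subset auto_image_conj_class[of \<phi> g]
    inj_on_subset[OF auto_inj, of \<phi> "conj_class G g"]
  by (auto simp: aut_perm_def Bij_def bij_betw_def conj_stabilizer_singleton)

lemma subgroup_AD:
  assumes g: "g \<in> carrier G" and M: "M \<subseteq> carrier G"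
  shows "subgroup (AD G M g) (BijGroup (conj_class G g))"
proof -
  let ?P = "conj_class G g" and ?B = "BijGroup (carrier G)"
  let ?N = "conj_stabilizer {g} \<inter> conj_stabilizer M"
  have sub: "subgroup ?N ?B"
    using g M by (intro group.subgroups_Inter_pair[OF group_BijGroup] subgroup_conj_stabilizer) auto
  have "aut_perm G g (a \<otimes>\<^bsub>?B\<^esub> b) = aut_perm G g a \<otimes>\<^bsub>BijGroup ?P\<^esub> aut_perm G g b"
    if "a \<in> ?N" "b \<in> ?N" for a b
  proof -
    have ab: "a \<in> Bij (carrier G)" "b \<in> Bij (carrier G)"
      using that by (auto simp: conj_stabilizer_def auto_def)
    have "b u \<in> ?P" if "u \<in> ?P" for u
      using auto_image_conj_class[of b g] \<open>b \<in> ?N\<close> g that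
      by (auto simp: conj_stabilizer_singleton)
    then show ?thesis
      using that ab g conj_class_subset[OF g]
      by (auto simp: aut_perm_Bij BijGroup_def compose_def fun_eq_iff) (auto simp: aut_perm_def)
  qed
  then have "aut_perm G g \<in> hom (?B\<lparr>carrier := ?N\<rparr>) (BijGroup ?P)"
    using g by (auto simp: hom_def aut_perm_Bij) (auto simp: BijGroup_def aut_perm_Bij)
  then interpret r: group_hom "?B\<lparr>carrier := ?N\<rparr>" "BijGroup ?P" "aut_perm G g"
    using group_BijGroup subgroup.subgroup_is_group[OF sub group_BijGroup]
    by (simp add: group_hom_def group_hom_axioms_def)
  show ?thesis using r.img_is_subgroup by (simp add: AD_eq_image)
qed

lemma conj_perm_eq_aut_perm:
  assumes "g \<in> carrier G"
  shows "conj_perm G g x = aut_perm G g (\<lambda>u\<in>carrier G. conj_elem G u x)"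
  using conj_class_subset[OF assms] unfolding conj_perm_def aut_perm_def
  by (intro restrict_ext) auto

lemma inner_conj_stabilizer:
  assumes "S \<subseteq> carrier G" "x \<in> carrier G"
  shows "(\<lambda>u\<in>carrier G. conj_elem G u x) \<in> conj_stabilizer S"
proof -
  have "(\<lambda>u\<in>carrier G. conj_elem G u x) ` S = conj_set G S x"
    unfolding conj_set_eq_image using assms by (intro image_cong) auto
  then show ?thesis
    using inner_auto assms by (auto simp: conj_stabilizer_def)
qed

lemma conj_perm_Bij:
  assumes "g \<in> carrier G" "x \<in> carrier G"
  shows "conj_perm G g x \<in> Bij (conj_class G g)"
  using assms by (simp add: conj_perm_eq_aut_perm aut_perm_Bij inner_conj_stabilizer)

lemma conj_perms_subset_AD:
  assumes "g \<in> carrier G" "M \<subseteq> carrier G"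
  shows "conj_perms G g \<subseteq> AD G M g"
  using assms
  by (auto simp: conj_perms_def AD_eq_image conj_perm_eq_aut_perm inner_conj_stabilizer)

text \<open>Conjugation \<open>u \<mapsto> u\<^sup>x\<close> is a right action, while \<^const>\<open>BijGroup\<close> composes from right to
  left; inverting \<open>x\<close> reconciles the two.\<close>

lemma conj_perm_inv_hom:
  assumes "g \<in> carrier G"
  shows "(\<lambda>x. conj_perm G g (inv x)) \<in> hom G (BijGroup (conj_class G g))"
proof (rule homI)
  fix x y assume xy: "x \<in> carrier G" "y \<in> carrier G"
  have "conj_perm G g (inv (x \<otimes> y)) =
      compose (conj_class G g) (conj_perm G g (inv x)) (conj_perm G g (inv y))"
    using xy assms conj_class_subset[OF assms]
    by (auto simp: conj_perm_def compose_def fun_eq_iff conj_elem_class conj_elem_mult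
        inv_mult_group subset_iff)
  then show "conj_perm G g (inv (x \<otimes> y)) =
      conj_perm G g (inv x) \<otimes>\<^bsub>BijGroup (conj_class G g)\<^esub> conj_perm G g (inv y)"
    using xy assms by (simp add: BijGroup_def conj_perm_Bij)
qed (use assms in \<open>simp add: BijGroup_def conj_perm_Bij\<close>)

lemma conj_perms_eq_image:
  "conj_perms G g = (\<lambda>x. conj_perm G g (inv x)) ` carrier G"
proof
  show "conj_perms G g \<subseteq> (\<lambda>x. conj_perm G g (inv x)) ` carrier G"
  proof
    fix p assume "p \<in> conj_perms G g"
    then obtain x where "x \<in> carrier G" "p = conj_perm G g x"
      by (auto simp: conj_perms_def)
    then show "p \<in> (\<lambda>x. conj_perm G g (inv x)) ` carrier G"
      by (intro image_eqI[where x = "inv x"]) auto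
  qed
qed (auto simp: conj_perms_def)

lemma subgroup_conj_perms:
  assumes "g \<in> carrier G"
  shows "subgroup (conj_perms G g) (BijGroup (conj_class G g))"
proof -
  interpret h: group_hom G "BijGroup (conj_class G g)" "\<lambda>x. conj_perm G g (inv x)"
    using conj_perm_inv_hom[OF assms] group_BijGroup
    by (simp add: group_hom_def group_hom_axioms_def)
  show ?thesis using h.img_is_subgroup by (simp add: conj_perms_eq_image)
qed

section \<open>Automorphisms of the design\<close>

text \<open>Intersecting \<open>\<phi> ` M = M\<^sup>x\<close> with the invariant class \<open>P\<close> shows that \<open>\<phi>\<close> maps the base block
  \<open>M \<inter> P\<close> to the block \<open>(M \<inter> P)\<^sup>x\<close>. Every other block is a conjugate of \<open>M \<inter> P\<close>, and
  automorphisms map conjugates to conjugates.\<close>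

lemma AD_subset_design_aut:
  assumes g: "g \<in> carrier G" and M: "M \<subseteq> carrier G"
  shows "AD G M g \<subseteq> design_aut (conj_design G M g)"
proof
  let ?P = "conj_class G g"
  note P = conj_class_subset[OF g]
  fix f assume "f \<in> AD G M g"
  then obtain \<phi> x where f: "f = aut_perm G g \<phi>" and \<phi>: "\<phi> \<in> auto G" "\<phi> g \<in> ?P"
    and x: "x \<in> carrier G" "\<phi> ` M = conj_set G M x"
    by (auto simp: AD_def)
  have MP: "M \<inter> ?P \<subseteq> carrier G" using M by auto
  have base: "\<phi> ` (M \<inter> ?P) = conj_set G (M \<inter> ?P) x"
    using inj_on_image_Int[OF auto_inj[OF \<phi>(1)] M P] auto_image_conj_class[OF \<phi>(1) g \<phi>(2)]
      conj_set_Int[OF M P x(1)] conj_set_conj_class[OF g x(1)] x(2) by simp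
  have "f ` conj_set G (M \<inter> ?P) y = conj_set G (M \<inter> ?P) (x \<otimes> \<phi> y)"
    if y: "y \<in> carrier G" for y
  proof -
    have "conj_set G (M \<inter> ?P) y \<subseteq> ?P"
      using g y by (auto simp: conj_set_eq_image conj_elem_class)
    then have "f ` conj_set G (M \<inter> ?P) y = \<phi> ` conj_set G (M \<inter> ?P) y"
      by (intro image_cong) (auto simp: f aut_perm_def)
    also have "\<dots> = conj_set G (M \<inter> ?P) (x \<otimes> \<phi> y)"
      using \<phi>(1) MP x(1) y by (simp add: auto_conj_set base conj_set_mult auto_closed)
    finally show ?thesis .
  qed
  moreover have "f \<in> Bij ?P"
    unfolding f using g \<phi> by (simp add: aut_perm_Bij conj_stabilizer_singleton)
  ultimately show "f \<in> design_aut (conj_design G M g)"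
    using x(1) auto_closed[OF \<phi>(1)]
    by (fastforce simp: design_aut_def conj_design_def points_def blocks_def)
qed

lemma points_conj_design: "points (conj_design G M g) = conj_class G g"
  by (simp add: conj_design_def points_def)

lemma subgroup_design_aut_conj_design:
  assumes "finite (carrier G)" "g \<in> carrier G"
  shows "subgroup (design_aut (conj_design G M g)) (BijGroup (conj_class G g))"
  using subgroup_design_aut[of "conj_design G M g"] one_design_conj_design[OF assms, of M]
  by (auto simp: one_design_def points_conj_design)

section \<open>Faithfulness of the conjugation action\<close>

lemma centre_normal: "{z \<in> carrier G. \<forall>x\<in>carrier G. z \<otimes> x = x \<otimes> z} \<lhd> G"
  (is "?Z \<lhd> G")
proof -
  have Z: "a \<in> carrier G" "x \<in> carrier G \<Longrightarrow> a \<otimes> x = x \<otimes> a" if "a \<in> ?Z" for a x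
    using that by blast+
  have "subgroup ?Z G"
  proof (rule subgroupI)
    fix a assume a: "a \<in> ?Z"
    have "inv a \<otimes> x = x \<otimes> inv a" if x: "x \<in> carrier G" for x
    proof -
      have "inv a \<otimes> x = inv (inv x \<otimes> a)" using Z(1)[OF a] x by (simp add: inv_mult_group)
      also have "\<dots> = inv (a \<otimes> inv x)" by (subst Z(2)[OF a]) (use x in auto)
      also have "\<dots> = x \<otimes> inv a" using Z(1)[OF a] x by (simp add: inv_mult_group)
      finally show ?thesis .
    qed
    then show "inv a \<in> ?Z" using Z(1)[OF a] by blast
    fix b assume b: "b \<in> ?Z"
    note ab = Z(1)[OF a] Z(1)[OF b]
    have "a \<otimes> b \<otimes> x = x \<otimes> (a \<otimes> b)" if x: "x \<in> carrier G" for x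
    proof -
      have "a \<otimes> b \<otimes> x = a \<otimes> (x \<otimes> b)" using ab x by (simp add: m_assoc Z(2)[OF b x])
      also have "\<dots> = x \<otimes> a \<otimes> b" using ab x by (simp add: Z(2)[OF a x] flip: m_assoc)
      finally show ?thesis using ab x by (simp add: m_assoc)
    qed
    then show "a \<otimes> b \<in> ?Z" using ab by blast
  next
    have "\<one> \<in> ?Z" by simp
    then show "?Z \<noteq> {}" by blast
  qed auto
  moreover have "x \<otimes> z \<otimes> inv x \<in> ?Z" if x: "x \<in> carrier G" and z: "z \<in> ?Z" for x z
  proof -
    have "x \<otimes> z \<otimes> inv x = z"
      using Z(1)[OF z] x by (subst Z(2)[OF z x, symmetric]) (simp add: m_assoc)
    then show ?thesis using z by (simp only:)
  qed
  ultimately show ?thesis unfolding normal_inv_iff by blast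
qed

lemma conj_elem_fixed_imp_commute:
  assumes "g \<in> carrier G" "x \<in> carrier G" "conj_elem G g x = g"
  shows "g \<otimes> x = x \<otimes> g"
proof -
  have "x \<otimes> conj_elem G g x = g \<otimes> x"
    using assms(1,2) by (simp add: conj_elem_def flip: m_assoc)
  then show ?thesis using assms(3) by simp
qed

lemma mem_conj_class_self: "g \<in> carrier G \<Longrightarrow> g \<in> conj_class G g"
  unfolding conj_class_def by (auto simp: conj_elem_one intro!: exI[of _ \<one>])

end

lemma (in simple_group) central_imp_one:
  assumes "\<not> comm_group G" "g \<in> carrier G" "\<And>x. x \<in> carrier G \<Longrightarrow> g \<otimes> x = x \<otimes> g"
  shows "g = \<one>"
proof (rule ccontr)
  let ?Z = "{z \<in> carrier G. \<forall>x\<in>carrier G. z \<otimes> x = x \<otimes> z}"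
  assume "g \<noteq> \<one>"
  moreover have "g \<in> ?Z" using assms by simp
  ultimately have "?Z = carrier G"
    using no_real_normal_subgroup[OF centre_normal] by blast
  then have "comm_group G" by (intro group_comm_groupI) blast
  then show False using assms(1) by simp
qed

text \<open>If the action on the class were trivial, then \<open>g\<close> itself would be fixed by all conjugations,
  that is, central. So the kernel is a proper normal subgroup.\<close>

lemma (in simple_group) iso_conj_perms_group:
  assumes "\<not> comm_group G" "g \<in> carrier G" "g \<noteq> \<one>"
  shows "G \<cong> conj_perms_group G g"
proof -
  let ?P = "conj_class G g"
  let ?h = "\<lambda>x. conj_perm G g (inv x)"
  interpret h: group_hom G "BijGroup ?P" ?h
    using conj_perm_inv_hom[OF assms(2)] group_BijGroup
    by (simp add: group_hom_def group_hom_axioms_def)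
  have "kernel G (BijGroup ?P) ?h \<noteq> carrier G"
  proof
    assume ker: "kernel G (BijGroup ?P) ?h = carrier G"
    have "g \<otimes> x = x \<otimes> g" if x: "x \<in> carrier G" for x
    proof -
      have "inv x \<in> kernel G (BijGroup ?P) ?h" using ker x by simp
      then have "conj_perm G g x = (\<lambda>u\<in>?P. u)"
        using x by (simp add: kernel_def BijGroup_def)
      then have "conj_elem G g x = g"
        using mem_conj_class_self[OF assms(2)] by (metis conj_perm_def restrict_apply')
      then show ?thesis using assms(2) x by (rule conj_elem_fixed_imp_commute[rotated 2])
    qed
    then show False using central_imp_one assms by blast
  qed
  then have "kernel G (BijGroup ?P) ?h = {\<one>}"
    using no_real_normal_subgroup[OF h.normal_kernel] by blast
  then have "inj_on ?h (carrier G)" by (rule h.trivial_ker_imp_inj)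
  then have "?h \<in> iso G (conj_perms_group G g)"
    using h.homh
    by (auto simp: iso_def hom_def bij_betw_def conj_perms_group_def conj_perms_eq_image)
  then show ?thesis by (rule is_isoI)
qed

theorem theorem4p2:
  fixes G :: "('a, 'b) monoid_scheme" (structure) and M :: "'a set" and g :: 'a
  assumes "simple_group G" and "finite (carrier G)" and "\<not> comm_group G"
    and "maximal_subgroup M G"
    and "g \<in> M - {\<one>}"
  shows "G \<cong> conj_perms_group G g
    \<and> subgroup (conj_perms G g) (AD_group G M g)
    \<and> subgroup (AD G M g) (design_aut_group (conj_design G M g))"
proof -
  interpret simple_group G by (rule assms(1))
  have M: "M \<subseteq> carrier G"
    using assms(4) by (simp add: maximal_subgroup_def subgroup.subset)
  then have g: "g \<in> carrier G" "g \<noteq> \<one>"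
    using assms(5) by auto
  note incl = group.subgroup_incl[OF group_BijGroup]
  have "subgroup (conj_perms G g) (AD_group G M g)"
    unfolding AD_group_def
    by (rule incl[OF subgroup_conj_perms[OF g(1)] subgroup_AD[OF g(1) M]
          conj_perms_subset_AD[OF g(1) M]])
  moreover have "subgroup (AD G M g) (design_aut_group (conj_design G M g))"
    unfolding design_aut_group_def points_conj_design
    by (rule incl[OF subgroup_AD[OF g(1) M] subgroup_design_aut_conj_design[OF assms(2) g(1)]
          AD_subset_design_aut[OF g(1) M]])
  ultimately show ?thesis
    using iso_conj_perms_group[OF assms(3) g] by simp
qed

end
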